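(* Assume that the MPSC piecewise weak constant rank condition (MPSC-PWCR) and the MPSC piecewise second-order quasi-normality (MPSC-PSOQN) both hold at $\bar{x}\in\mathcal{F}$. Then the local error bound of (MPSC) holds at $\bar{x}$.
   Context: (MPSC) is the problem: minimize $f(x)$ over $x\in\mathbb{R}^n$ subject to $g_i(x)\le 0$ ($i=1,\dots,m$), $h_j(x)=0$ ($j=1,\dots,p$), $G_k(x)H_k(x)=0$ ($k=1,\dots,l$), where $f,g_i,h_j,G_k,H_k:\mathbb{R}^n\to\mathbb{R}$ are twice continuously differentiable. $\mathcal{F}$ denotes its feasible set. For a feasible point $\bar{x}$: $\mathcal{I}_h=\{1,\dots,p\}$, $\mathcal{I}_g=\{i: g_i(\bar{x})=0\}$, $\mathcal{I}_G=\{k: G_k(\bar{x})=0,\,H_k(\bar{x})\neq0\}$, $\mathcal{I}_H=\{k: G_k(\bar{x})\ne0,\,H_k(\bar{x})=0\}$, $\mathcal{I}_{GH}=\{k: G_k(\bar{x})=H_k(\bar{x})=0\}$. $\mathcal{P}(\mathcal{I}_{GH})$ is the set of all pairs $(\beta_1,\beta_2)$ of disjoint (possibly empty) sets with $\beta_1\cup\beta_2=\mathcal{I}_{GH}$. MPSC-PWCR holds at $\bar{x}$ if for each $(\beta_1,\beta_2)\in\mathcal{P}(\mathcal{I}_{GH})$ there is $\varepsilon>0$ such that the rank of the family $\{\nabla g_i(x)\}_{i\in\mathcal{I}_g}\cup\{\nabla h_j(x)\}_{j\in\mathcal{I}_h}\cup\{\nabla G_k(x)\}_{k\in\mathcal{I}_G\cup\beta_1}\cup\{\nabla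 H_k(x)\}_{k\in\mathcal{I}_H\cup\beta_2}$ is constant for all $x$ with $\|x-\bar{x}\|<\varepsilon$. MPSC-PSOQN holds at $\bar{x}$ if for each $(\beta_1,\beta_2)\in\mathcal{P}(\mathcal{I}_{GH})$ there is no nonzero vector $(\lambda,\rho,\mu,\nu)$ (with $\lambda\in\mathbb{R}^m$, $\rho\in\mathbb{R}^p$, $\mu$ indexed by $\mathcal{I}_G\cup\beta_1$, $\nu$ indexed by $\mathcal{I}_H\cup\beta_2$) with $\lambda\ge0$ satisfying all of: (1) $\sum_{i=1}^m\lambda_i\nabla g_i(\bar{x})+\sum_{j=1}^p\rho_j\nabla h_j(\bar{x})+\sum_{k\in\mathcal{I}_G\cup\beta_1}\mu_k\nabla G_k(\bar{x})+\sum_{k\in\mathcal{I}_H\cup\beta_2}\nu_k\nabla H_k(\bar{x})=0$; (2) $\tilde d^\top\big(\sum_{i=1}^m\lambda_i\nabla^2 g_i(\bar{x})+\sum_{j=1}^p\rho_j\nabla^2 h_j(\bar{x})+\sum_{k\in\mathcal{I}_G\cup\beta_1}\mu_k\nabla^2 G_k(\bar{x})+\sum_{k\in\mathcal{I}_H\cup\beta_2}\nu_k\nabla^2 H_k(\bar{x})\big)\tilde d\ge0$ for all $\tilde d$ in the critical subspace $\{d\in\mathbb{R}^n:\nabla g_i(\bar{x})^\top d=0\ (i\in\mathcal{I}_g),\ \nabla h_j(\bar{x})^\top d=0\ (j\in\mathcal{I}_h),\ \nabla G_k(\bar{x})^\top d=0\ (k\in\mathcal{I}_G\cup\beta_1),\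 \nabla H_k(\bar{x})^\top d=0\ (k\in\mathcal{I}_H\cup\beta_2)\}$; (3) there is a sequence $x^s\to\bar{x}$ such that for each $s$: $\lambda_i>0\Rightarrow\lambda_ig_i(x^s)>0$; $\rho_j\ne0\Rightarrow\rho_jh_j(x^s)>0$; $\mu_k\neq0\Rightarrow\mu_kG_k(x^s)>0$; $\nu_k\ne0\Rightarrow\nu_kH_k(x^s)>0$. The local error bound of (MPSC) holds at $\bar{x}$ if there exist $\varepsilon,\alpha>0$ such that for all $x$ with $\|x-\bar{x}\|<\varepsilon$, $$\mathrm{dist}_{\mathcal{F}}(x)\le\alpha\Big(\sum_{i=1}^m[g_i^+(x)]^2+\sum_{j=1}^p[h_j(x)]^2+\sum_{k=1}^l\min\{[G_k(x)]^2,[H_k(x)]^2\}\Big)^{1/2},$$ where $g_i^+(x)=\max\{g_i(x),0\}$ and $\mathrm{dist}_{\mathcal{F}}(x)=\inf_{y\in\mathcal{F}}\|x-y\|$ (Euclidean norm). *)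

theory Defs
  imports "HOL-Analysis.Analysis"
begin

definition gradient :: "(real ^ 'n \<Rightarrow> real) \<Rightarrow> real ^ 'n \<Rightarrow> real ^ 'n" where
  "gradient f x = (THE D. GDERIV f x :> D)"

definition hessian :: "(real ^ 'n \<Rightarrow> real) \<Rightarrow> real ^ 'n \<Rightarrow> real ^ 'n ^ 'n" where
  "hessian f x = matrix (frechet_derivative (gradient f) (at x))"

definition twice_continuously_differentiable :: "(real ^ 'n \<Rightarrow> real) \<Rightarrow> bool" where
  "twice_continuously_differentiable f \<longleftrightarrow>
     (\<forall>x. f differentiable (at x)) \<and>
     (\<forall>x. gradient f differentiable (at x)) \<and>
     continuous_on UNIV (hessian f)"

text \<open>
  The constraint families are indexed from 1; their values outside
  \<open>{1..num_g}\<close>, \<open>{1..num_h}\<close> and \<open>{1..num_sw}\<close> are irrelevant.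
  Each of the three numbers may be 0.
\<close>

record ('n :: finite) mpsc =
  obj_f :: "real ^ 'n \<Rightarrow> real"
  num_g :: nat
  con_g :: "nat \<Rightarrow> real ^ 'n \<Rightarrow> real"
  num_h :: nat
  con_h :: "nat \<Rightarrow> real ^ 'n \<Rightarrow> real"
  num_sw :: nat
  sw_G :: "nat \<Rightarrow> real ^ 'n \<Rightarrow> real"
  sw_H :: "nat \<Rightarrow> real ^ 'n \<Rightarrow> real"

definition c2_mpsc :: "('n :: finite) mpsc \<Rightarrow> bool" where
  "c2_mpsc P \<longleftrightarrow>
     twice_continuously_differentiable (obj_f P) \<and>
     (\<forall>i\<in>{1..num_g P}. twice_continuously_differentiable (con_g P i)) \<and>
     (\<forall>j\<in>{1..num_h P}. twice_continuously_differentiable (con_h P j)) \<and>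
     (\<forall>k\<in>{1..num_sw P}. twice_continuously_differentiable (sw_G P k) \<and>
                        twice_continuously_differentiable (sw_H P k))"

definition feasible_set :: "('n :: finite) mpsc \<Rightarrow> (real ^ 'n) set" where
  "feasible_set P = {x.
     (\<forall>i\<in>{1..num_g P}. con_g P i x \<le> 0) \<and>
     (\<forall>j\<in>{1..num_h P}. con_h P j x = 0) \<and>
     (\<forall>k\<in>{1..num_sw P}. sw_G P k x * sw_H P k x = 0)}"

definition idx_h :: "('n :: finite) mpsc \<Rightarrow> nat set" where
  "idx_h P = {1..num_h P}"

definition idx_g :: "('n :: finite) mpsc \<Rightarrow> real ^ 'n \<Rightarrow> nat set" where
  "idx_g P x = {i\<in>{1..num_g P}. con_g P i x = 0}"

definition idx_G :: "('n :: finite) mpsc \<Rightarrow> real ^ 'n \<Rightarrow> nat set" where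
  "idx_G P x = {k\<in>{1..num_sw P}. sw_G P k x = 0 \<and> sw_H P k x \<noteq> 0}"

definition idx_H :: "('n :: finite) mpsc \<Rightarrow> real ^ 'n \<Rightarrow> nat set" where
  "idx_H P x = {k\<in>{1..num_sw P}. sw_G P k x \<noteq> 0 \<and> sw_H P k x = 0}"

definition idx_GH :: "('n :: finite) mpsc \<Rightarrow> real ^ 'n \<Rightarrow> nat set" where
  "idx_GH P x = {k\<in>{1..num_sw P}. sw_G P k x = 0 \<and> sw_H P k x = 0}"

definition bipartitions :: "nat set \<Rightarrow> (nat set \<times> nat set) set" where
  "bipartitions S = {(\<beta>1, \<beta>2). \<beta>1 \<inter> \<beta>2 = {} \<and> \<beta>1 \<union> \<beta>2 = S}"

text \<open>
  In \<open>branch_gradients P xbar \<beta>1 \<beta>2 x\<close> the index sets are those of the reference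
  point \<open>xbar\<close>, whereas the gradients are evaluated at \<open>x\<close>. The rank of the family is
  \<open>dim\<close> of this set, the dimension of its linear span.
\<close>

definition branch_gradients ::
  "('n :: finite) mpsc \<Rightarrow> real ^ 'n \<Rightarrow> nat set \<Rightarrow> nat set \<Rightarrow> real ^ 'n \<Rightarrow> (real ^ 'n) set" where
  "branch_gradients P xbar \<beta>1 \<beta>2 x =
     (\<lambda>i. gradient (con_g P i) x) ` idx_g P xbar \<union>
     (\<lambda>j. gradient (con_h P j) x) ` idx_h P \<union>
     (\<lambda>k. gradient (sw_G P k) x) ` (idx_G P xbar \<union> \<beta>1) \<union>
     (\<lambda>k. gradient (sw_H P k) x) ` (idx_H P xbar \<union> \<beta>2)"

definition mpsc_pwcr :: "('n :: finite) mpsc \<Rightarrow> real ^ 'n \<Rightarrow> bool" where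
  "mpsc_pwcr P xbar \<longleftrightarrow>
     (\<forall>(\<beta>1, \<beta>2) \<in> bipartitions (idx_GH P xbar).
        \<exists>\<epsilon>>0. \<exists>r. \<forall>x. norm (x - xbar) < \<epsilon> \<longrightarrow> dim (branch_gradients P xbar \<beta>1 \<beta>2 x) = r)"

definition critical_subspace ::
  "('n :: finite) mpsc \<Rightarrow> real ^ 'n \<Rightarrow> nat set \<Rightarrow> nat set \<Rightarrow> (real ^ 'n) set" where
  "critical_subspace P xbar \<beta>1 \<beta>2 = {d.
     (\<forall>i\<in>idx_g P xbar. gradient (con_g P i) xbar \<bullet> d = 0) \<and>
     (\<forall>j\<in>idx_h P. gradient (con_h P j) xbar \<bullet> d = 0) \<and>
     (\<forall>k\<in>idx_G P xbar \<union> \<beta>1. gradient (sw_G P k) xbar \<bullet> d = 0) \<and>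
     (\<forall>k\<in>idx_H P xbar \<union> \<beta>2. gradient (sw_H P k) xbar \<bullet> d = 0)}"

text \<open>
  A multiplier vector is given by functions on \<open>nat\<close>, of which only the values on the
  respective index sets matter; this includes being nonzero.
\<close>

definition psoqn_multiplier ::
  "('n :: finite) mpsc \<Rightarrow> real ^ 'n \<Rightarrow> nat set \<Rightarrow> nat set \<Rightarrow>
   (nat \<Rightarrow> real) \<Rightarrow> (nat \<Rightarrow> real) \<Rightarrow> (nat \<Rightarrow> real) \<Rightarrow> (nat \<Rightarrow> real) \<Rightarrow> bool" where
  "psoqn_multiplier P xbar \<beta>1 \<beta>2 lam rho mu nu \<longleftrightarrow>
     ((\<exists>i\<in>{1..num_g P}. lam i \<noteq> 0) \<or> (\<exists>j\<in>{1..num_h P}. rho j \<noteq> 0) \<or>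
      (\<exists>k\<in>idx_G P xbar \<union> \<beta>1. mu k \<noteq> 0) \<or> (\<exists>k\<in>idx_H P xbar \<union> \<beta>2. nu k \<noteq> 0)) \<and>
     (\<forall>i\<in>{1..num_g P}. lam i \<ge> 0) \<and>
     (\<Sum>i=1..num_g P. lam i *\<^sub>R gradient (con_g P i) xbar) +
     (\<Sum>j=1..num_h P. rho j *\<^sub>R gradient (con_h P j) xbar) +
     (\<Sum>k\<in>idx_G P xbar \<union> \<beta>1. mu k *\<^sub>R gradient (sw_G P k) xbar) +
     (\<Sum>k\<in>idx_H P xbar \<union> \<beta>2. nu k *\<^sub>R gradient (sw_H P k) xbar) = 0 \<and>
     (\<forall>d\<in>critical_subspace P xbar \<beta>1 \<beta>2.
        d \<bullet> (((\<Sum>i=1..num_g P. lam i *\<^sub>R hessian (con_g P i) xbar) +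
              (\<Sum>j=1..num_h P. rho j *\<^sub>R hessian (con_h P j) xbar) +
              (\<Sum>k\<in>idx_G P xbar \<union> \<beta>1. mu k *\<^sub>R hessian (sw_G P k) xbar) +
              (\<Sum>k\<in>idx_H P xbar \<union> \<beta>2. nu k *\<^sub>R hessian (sw_H P k) xbar)) *v d) \<ge> 0) \<and>
     (\<exists>xs. xs \<longlonglongrightarrow> xbar \<and>
        (\<forall>s :: nat.
           (\<forall>i\<in>{1..num_g P}. lam i > 0 \<longrightarrow> lam i * con_g P i (xs s) > 0) \<and>
           (\<forall>j\<in>{1..num_h P}. rho j \<noteq> 0 \<longrightarrow> rho j * con_h P j (xs s) > 0) \<and>
           (\<forall>k\<in>idx_G P xbar \<union> \<beta>1. mu k \<noteq> 0 \<longrightarrow> mu k * sw_G P k (xs s) > 0) \<and>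
           (\<forall>k\<in>idx_H P xbar \<union> \<beta>2. nu k \<noteq> 0 \<longrightarrow> nu k * sw_H P k (xs s) > 0)))"

definition mpsc_psoqn :: "('n :: finite) mpsc \<Rightarrow> real ^ 'n \<Rightarrow> bool" where
  "mpsc_psoqn P xbar \<longleftrightarrow>
     (\<forall>(\<beta>1, \<beta>2) \<in> bipartitions (idx_GH P xbar).
        \<not> (\<exists>lam rho mu nu. psoqn_multiplier P xbar \<beta>1 \<beta>2 lam rho mu nu))"

text \<open>
  The distance is \<open>infdist\<close>, which is the infimum of the Euclidean distances whenever the
  feasible set is nonempty, in particular when it contains \<open>xbar\<close>.
\<close>

definition local_error_bound :: "('n :: finite) mpsc \<Rightarrow> real ^ 'n \<Rightarrow> bool" where
  "local_error_bound P xbar \<longleftrightarrow>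
     (\<exists>\<epsilon>>0. \<exists>\<alpha>>0. \<forall>x. norm (x - xbar) < \<epsilon> \<longrightarrow>
        infdist x (feasible_set P) \<le>
          \<alpha> * sqrt ((\<Sum>i=1..num_g P. (max (con_g P i x) 0)\<^sup>2) +
                   (\<Sum>j=1..num_h P. (con_h P j x)\<^sup>2) +
                   (\<Sum>k=1..num_sw P. min ((sw_G P k x)\<^sup>2) ((sw_H P k x)\<^sup>2))))"

end

theory Submission
  imports Defs
begin

text \<open>
  The feasible set contains, for every partition \<open>(\<beta>1, \<beta>2)\<close> of the biactive indices, the solution
  set of an ordinary system of inequalities and equations, the branch, in which one factor of each
  switching constraint is required to vanish. Near \<open>xbar\<close>, the residual of the program at \<open>x\<close> equals
  the residual of the branch that picks the smaller factors at \<open>x\<close> (\<open>eventually_branch_residual_eq\<close>).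
  The distance to the feasible set is at most the distance to a branch, and there are finitely many
  branches, so an error bound for each branch is enough.

  An error bound for a branch follows from first-order quasi-normality, which is the absence of
  nonzero multipliers satisfying stationarity and the sign condition along a sequence
  (\<open>quasinormality_imp_error_bound\<close>): where the bound fails, minimising the residual with a small
  quadratic penalty yields points at which the gradient of the residual is nearly zero, and the
  normalised violations at these points converge to a forbidden multiplier.

  It remains to pass from second-order to first-order quasi-normality, and this is the role of the
  rank condition. If the rank of the active gradients is locally constant, then for every linear
  relation between these gradients at \<open>xbar\<close> the same combination of the Hessians vanishes as a
  quadratic form on the critical subspace (\<open>constant_rank_curvature_zero\<close>). The second-order
  condition on multipliers is thus satisfied automatically, with equality, so second-order
  quasi-normality excludes all first-order multipliers (\<open>branch_quasinormality\<close>).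
\<close>

section \<open>Families of constant rank\<close>

text \<open>
  The bound comes from dual functionals: an independent family has linear functionals that
  read off its coefficients, and linear functionals on a Euclidean space are bounded.
\<close>

lemma independent_family_coefficient_bound:
  fixes v :: "'k \<Rightarrow> 'a::euclidean_space"
  assumes fin: "finite B" and inj: "inj_on v B" and indep: "independent (v ` B)"
  obtains K where "K > 0" "\<And>w. (\<Sum>k\<in>B. \<bar>w k\<bar>) \<le> K * norm (\<Sum>k\<in>B. w k *\<^sub>R v k)"
proof -
  have "\<exists>g. linear g \<and> (\<forall>j\<in>B. g (v j) = (if j = k then 1 else 0 :: real))" for k
  proof -
    obtain g :: "'a \<Rightarrow> real" where g: "linear g"
      "\<forall>y\<in>v ` B. g y = (if inv_into B v y = k then 1 else 0)"
      using linear_independent_extend[OF indep, of "\<lambda>y. if inv_into B v y = k then 1 else 0"] by auto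
    then show ?thesis using inj by (intro exI[of _ g]) auto
  qed
  then obtain g where g: "\<And>k. linear (g k)"
    "\<And>k j. j \<in> B \<Longrightarrow> g k (v j) = (if j = k then 1 else 0 :: real)"
    by metis
  have "\<exists>c>0. \<forall>y. \<bar>g k y\<bar> \<le> c * norm y" for k
    using linear_bounded_pos[OF g(1)[of k]] by (metis real_norm_def)
  then obtain c where c: "\<And>k. c k > 0" "\<And>k y. \<bar>g k y\<bar> \<le> c k * norm y"
    by metis
  have coeff: "g k (\<Sum>j\<in>B. w j *\<^sub>R v j) = w k" if "k \<in> B" for k w
  proof -
    have "g k (\<Sum>j\<in>B. w j *\<^sub>R v j) = (\<Sum>j\<in>B. w j * (if j = k then 1 else 0))"
      using g(2) by (simp add: linear_sum[OF g(1)] linear_scale[OF g(1)])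
    also have "\<dots> = (\<Sum>j\<in>B. if j = k then w j else 0)"
      by (intro sum.cong) auto
    finally show ?thesis
      using that fin by simp
  qed
  show thesis
  proof (rule that)
    show "1 + (\<Sum>k\<in>B. c k) > 0"
      using c(1) by (intro add_pos_nonneg sum_nonneg) (auto intro: less_imp_le)
    fix w
    have "(\<Sum>k\<in>B. \<bar>w k\<bar>) \<le> (\<Sum>k\<in>B. c k * norm (\<Sum>j\<in>B. w j *\<^sub>R v j))"
    proof (rule sum_mono)
      fix k assume "k \<in> B"
      then show "\<bar>w k\<bar> \<le> c k * norm (\<Sum>j\<in>B. w j *\<^sub>R v j)"
        using c(2)[of k "\<Sum>j\<in>B. w j *\<^sub>R v j"] coeff[of k w] by simp
    qed
    also have "\<dots> \<le> (1 + (\<Sum>k\<in>B. c k)) * norm (\<Sum>j\<in>B. w j *\<^sub>R v j)"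
      by (simp add: sum_distrib_right distrib_right)
    finally show "(\<Sum>k\<in>B. \<bar>w k\<bar>) \<le> (1 + (\<Sum>k\<in>B. c k)) * norm (\<Sum>k\<in>B. w k *\<^sub>R v k)" .
  qed
qed

lemma independent_family_if_scalars_zero:
  fixes v :: "'k \<Rightarrow> 'a::real_vector"
  assumes fin: "finite B"
    and zero: "\<And>w k. (\<Sum>k\<in>B. w k *\<^sub>R v k) = 0 \<Longrightarrow> k \<in> B \<Longrightarrow> w k = 0"
  shows "inj_on v B" and "independent (v ` B)"
proof -
  show inj: "inj_on v B"
  proof (rule inj_onI, rule ccontr)
    fix i j assume ij: "i \<in> B" "j \<in> B" "v i = v j" "i \<noteq> j"
    let ?w = "\<lambda>k. (if k = i then 1 else 0) - (if k = j then 1 else 0) :: real"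
    have "(\<Sum>k\<in>B. ?w k *\<^sub>R v k) = (\<Sum>k\<in>B. (if k = i then v k else 0) - (if k = j then v k else 0))"
      by (intro sum.cong) (auto simp: scaleR_diff_left)
    also have "\<dots> = 0"
      using ij fin by (simp add: sum_subtractf)
    finally show False
      using zero[of ?w i] ij by simp
  qed
  show "independent (v ` B)"
  proof (rule independent_if_scalars_zero)
    fix f x assume "(\<Sum>x\<in>v ` B. f x *\<^sub>R x) = 0" and x: "x \<in> v ` B"
    then have "(\<Sum>k\<in>B. f (v k) *\<^sub>R v k) = 0"
      by (simp add: sum.reindex[OF inj])
    then show "f x = 0" using zero x by auto
  qed (use fin in auto)
qed

lemma span_family_representation:
  fixes v :: "'k \<Rightarrow> 'a::real_vector"
  assumes fin: "finite B" and inj: "inj_on v B" and y: "y \<in> span (v ` B)"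
  obtains w where "y = (\<Sum>k\<in>B. w k *\<^sub>R v k)"
proof -
  obtain u where "y = (\<Sum>x\<in>v ` B. u x *\<^sub>R x)"
    using y span_finite[of "v ` B"] fin by auto
  then show thesis
    using that[of "\<lambda>k. u (v k)"] by (simp add: sum.reindex[OF inj])
qed

text \<open>
  Indices \<open>B\<close> whose vectors form a basis of the span at \<open>x0\<close> stay independent near \<open>x0\<close>,
  because the coefficient bound survives small perturbations of the family. Since the rank does
  not jump, these \<open>card B = r\<close> vectors still span the whole family, so every vector of the span
  has coefficients over \<open>B\<close>, controlled by its norm with the same constant at all nearby points.
\<close>

lemma constant_rank_stable_representation:
  fixes a :: "'k \<Rightarrow> 'a::euclidean_space \<Rightarrow> 'a"
  assumes fin: "finite I"
    and cont: "\<And>k. k \<in> I \<Longrightarrow> isCont (a k) x0"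
    and rank: "\<forall>\<^sub>F x in nhds x0. dim ((\<lambda>k. a k x) ` I) = r"
  obtains B K where "B \<subseteq> I" "K > 0"
    "\<forall>\<^sub>F x in nhds x0. \<forall>y \<in> span ((\<lambda>k. a k x) ` I).
       \<exists>w. y = (\<Sum>k\<in>B. w k *\<^sub>R a k x) \<and> (\<Sum>k\<in>B. \<bar>w k\<bar>) \<le> K * norm y"
proof -
  have "dim ((\<lambda>k. a k x0) ` I) = r"
    using rank by (rule eventually_nhds_x_imp_x)
  then obtain C where C: "C \<subseteq> (\<lambda>k. a k x0) ` I" "independent C" "card C = r"
    using basis_exists by metis
  then obtain B where B: "B \<subseteq> I" "inj_on (\<lambda>k. a k x0) B" "C = (\<lambda>k. a k x0) ` B"
    by (auto simp: subset_image_inj)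
  have finB: "finite B" using B(1) fin finite_subset by blast
  have cardB: "card B = r" using C(3) B(2,3) card_image by fastforce
  obtain K where K: "K > 0" "\<And>w. (\<Sum>k\<in>B. \<bar>w k\<bar>) \<le> K * norm (\<Sum>k\<in>B. w k *\<^sub>R a k x0)"
    using independent_family_coefficient_bound[OF finB B(2)] C(2) B(3) by metis
  have "\<forall>k\<in>B. \<forall>\<^sub>F x in nhds x0. norm (a k x - a k x0) < 1 / (2 * K)"
  proof
    fix k assume "k \<in> B"
    then have "((a k) \<longlongrightarrow> a k x0) (nhds x0)"
      using cont B(1) by (simp add: isCont_def tendsto_at_iff_tendsto_nhds subset_eq)
    then show "\<forall>\<^sub>F x in nhds x0. norm (a k x - a k x0) < 1 / (2 * K)"
      using K(1) by (auto simp: tendsto_iff dist_norm)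
  qed
  then have near: "\<forall>\<^sub>F x in nhds x0. \<forall>k\<in>B. norm (a k x - a k x0) < 1 / (2 * K)"
    by (simp add: eventually_ball_finite finB)
  show thesis
  proof (rule that)
    show "B \<subseteq> I" by fact
    show "2 * K > 0" using K by simp
    show "\<forall>\<^sub>F x in nhds x0. \<forall>y \<in> span ((\<lambda>k. a k x) ` I).
       \<exists>w. y = (\<Sum>k\<in>B. w k *\<^sub>R a k x) \<and> (\<Sum>k\<in>B. \<bar>w k\<bar>) \<le> 2 * K * norm y"
      using near rank
    proof eventually_elim
      case (elim x)
      have bound: "(\<Sum>k\<in>B. \<bar>w k\<bar>) \<le> 2 * K * norm (\<Sum>k\<in>B. w k *\<^sub>R a k x)" for w
      proof -
        have "norm (\<Sum>k\<in>B. w k *\<^sub>R (a k x0 - a k x)) \<le> (\<Sum>k\<in>B. \<bar>w k\<bar> * (1 / (2 * K)))"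
        proof (rule sum_norm_le)
          fix k assume "k \<in> B"
          then have "norm (a k x0 - a k x) \<le> 1 / (2 * K)"
            using elim(1) by (simp add: norm_minus_commute less_imp_le)
          then have "\<bar>w k\<bar> * norm (a k x0 - a k x) \<le> \<bar>w k\<bar> * (1 / (2 * K))"
            by (rule mult_left_mono) simp
          then show "norm (w k *\<^sub>R (a k x0 - a k x)) \<le> \<bar>w k\<bar> * (1 / (2 * K))"
            by simp
        qed
        then have diff: "norm (\<Sum>k\<in>B. w k *\<^sub>R (a k x0 - a k x)) \<le> (\<Sum>k\<in>B. \<bar>w k\<bar>) / (2 * K)"
          by (simp add: sum_divide_distrib)
        have split: "(\<Sum>k\<in>B. w k *\<^sub>R a k x0) =
            (\<Sum>k\<in>B. w k *\<^sub>R a k x) + (\<Sum>k\<in>B. w k *\<^sub>R (a k x0 - a k x))"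
          by (simp add: sum.distrib[symmetric] scaleR_diff_right)
        have "norm (\<Sum>k\<in>B. w k *\<^sub>R a k x0) \<le>
            norm (\<Sum>k\<in>B. w k *\<^sub>R a k x) + (\<Sum>k\<in>B. \<bar>w k\<bar>) / (2 * K)"
          unfolding split using diff by (rule norm_triangle_le[OF add_left_mono])
        then have "K * norm (\<Sum>k\<in>B. w k *\<^sub>R a k x0) \<le>
            K * (norm (\<Sum>k\<in>B. w k *\<^sub>R a k x) + (\<Sum>k\<in>B. \<bar>w k\<bar>) / (2 * K))"
          using K(1) by (intro mult_left_mono) auto
        also have "\<dots> = K * norm (\<Sum>k\<in>B. w k *\<^sub>R a k x) + (\<Sum>k\<in>B. \<bar>w k\<bar>) / 2"
          using K(1) by (simp add: distrib_left)
        finally show ?thesis using K(2)[of w] by linarith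
      qed
      have zero: "w k = 0" if "(\<Sum>k\<in>B. w k *\<^sub>R a k x) = 0" "k \<in> B" for w k
      proof -
        have "(\<Sum>k\<in>B. \<bar>w k\<bar>) \<le> 0" using bound[of w] that(1) by simp
        then have "(\<Sum>k\<in>B. \<bar>w k\<bar>) = 0" by (intro antisym sum_nonneg) auto
        then show ?thesis using finB that(2) by (simp add: sum_nonneg_eq_0_iff)
      qed
      have indep: "inj_on (\<lambda>k. a k x) B" "independent ((\<lambda>k. a k x) ` B)"
        by (rule independent_family_if_scalars_zero[OF finB]; erule (1) zero)+
      have "(\<lambda>k. a k x) ` I \<subseteq> span ((\<lambda>k. a k x) ` B)"
        using B(1) indep(2) elim(2) cardB card_image[OF indep(1)]
        by (intro card_ge_dim_independent) auto
      then have "span ((\<lambda>k. a k x) ` I) \<subseteq> span ((\<lambda>k. a k x) ` B)"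
        by (rule span_minimal) (rule subspace_span)
      moreover have "\<exists>w. y = (\<Sum>k\<in>B. w k *\<^sub>R a k x) \<and> (\<Sum>k\<in>B. \<bar>w k\<bar>) \<le> 2 * K * norm y"
        if y: "y \<in> span ((\<lambda>k. a k x) ` B)" for y
      proof -
        obtain w where "y = (\<Sum>k\<in>B. w k *\<^sub>R a k x)"
          using span_family_representation[OF finB indep(1) y] by blast
        then show ?thesis using bound[of w] by blast
      qed
      ultimately show ?case by blast
    qed
  qed
qed

text \<open>
  This is where the rank condition enters. Let \<open>S x\<close> be the combination of the family with the
  fixed weights \<open>u\<close>, so that \<open>S x0 = 0\<close>. Near \<open>x0\<close> it can be rewritten over the stable basis \<open>B\<close>
  with coefficients of size \<open>O(norm (S x))\<close>, which tend to \<open>0\<close>. Along the line \<open>x0 + t d\<close> the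
  products \<open>d \<bullet> a k\<close> are \<open>O(t)\<close>, because they vanish at \<open>t = 0\<close>. Hence \<open>d \<bullet> S\<close> is \<open>o(t)\<close>, which
  says that its derivative, the curvature form below, vanishes.

  If \<open>a k\<close> is the gradient of a twice continuously differentiable function \<open>c k\<close>, this is a
  consequence of the constant rank theorem: all \<open>c k\<close> are constant along a curve leaving \<open>x0\<close>
  in direction \<open>d\<close>, and differentiating \<open>\<Sum>k. u k * c k\<close> twice along this curve leaves only the Hessian term.
\<close>

lemma constant_rank_curvature_zero:
  fixes a :: "'k \<Rightarrow> 'a::euclidean_space \<Rightarrow> 'a"
  assumes fin: "finite I"
    and deriv: "\<And>k. k \<in> I \<Longrightarrow> (a k has_derivative a' k) (at x0)"
    and rank: "\<forall>\<^sub>F x in nhds x0. dim ((\<lambda>k. a k x) ` I) = r"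
    and stat: "(\<Sum>k\<in>I. u k *\<^sub>R a k x0) = 0"
    and crit: "\<And>k. k \<in> I \<Longrightarrow> a k x0 \<bullet> d = 0"
  shows "d \<bullet> (\<Sum>k\<in>I. u k *\<^sub>R a' k d) = 0"
proof -
  define S where "S x = (\<Sum>k\<in>I. u k *\<^sub>R a k x)" for x
  have cont: "isCont (a k) x0" if "k \<in> I" for k
    using deriv[OF that] by (rule has_derivative_continuous)
  obtain B K where B: "B \<subseteq> I" "K > 0" and rep:
    "\<forall>\<^sub>F x in nhds x0. \<forall>y \<in> span ((\<lambda>k. a k x) ` I).
       \<exists>w. y = (\<Sum>k\<in>B. w k *\<^sub>R a k x) \<and> (\<Sum>k\<in>B. \<bar>w k\<bar>) \<le> K * norm y"
    using constant_rank_stable_representation[OF fin cont rank] by blast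
  have finB: "finite B" using B(1) fin finite_subset by blast
  have near: "\<forall>\<^sub>F x in nhds x0. \<bar>d \<bullet> S x\<bar> \<le> K * norm (S x) * (\<Sum>k\<in>B. \<bar>d \<bullet> a k x\<bar>)"
    using rep
  proof eventually_elim
    case (elim x)
    have "S x \<in> span ((\<lambda>k. a k x) ` I)"
      unfolding S_def by (intro span_sum span_scale span_base) auto
    then obtain w where w: "S x = (\<Sum>k\<in>B. w k *\<^sub>R a k x)" "(\<Sum>k\<in>B. \<bar>w k\<bar>) \<le> K * norm (S x)"
      using elim by blast
    have "\<bar>d \<bullet> S x\<bar> \<le> (\<Sum>k\<in>B. \<bar>w k\<bar> * \<bar>d \<bullet> a k x\<bar>)"
      unfolding w(1) inner_sum_right by (rule order_trans[OF sum_abs]) (simp add: abs_mult)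
    also have "\<dots> \<le> (\<Sum>k\<in>B. (K * norm (S x)) * \<bar>d \<bullet> a k x\<bar>)"
    proof (intro sum_mono mult_right_mono)
      fix k assume "k \<in> B"
      then have "\<bar>w k\<bar> \<le> (\<Sum>k\<in>B. \<bar>w k\<bar>)" using finB by (intro member_le_sum) auto
      then show "\<bar>w k\<bar> \<le> K * norm (S x)" using w(2) by linarith
    qed auto
    finally show ?case by (simp add: sum_distrib_left)
  qed
  \<comment> \<open>criticality of \<open>d\<close> removes the value at \<open>t = 0\<close> from the difference quotients\<close>
  have line: "((\<lambda>t. (d \<bullet> a k (x0 + t *\<^sub>R d)) / t) \<longlongrightarrow> d \<bullet> a' k d) (at (0::real))"
    if "k \<in> I" for k
  proof -
    have "((\<lambda>t. d \<bullet> a k (x0 + t *\<^sub>R d)) has_derivative (\<lambda>t. d \<bullet> a' k (t *\<^sub>R d))) (at 0)"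
      using deriv[OF that]
      by (intro has_derivative_inner_right has_derivative_compose[of "\<lambda>t. x0 + t *\<^sub>R d" _ _ _ "a k"])
         (auto intro!: derivative_eq_intros)
    then have "((\<lambda>t. d \<bullet> a k (x0 + t *\<^sub>R d)) has_field_derivative d \<bullet> a' k d) (at 0)"
      using linear_scale[OF has_derivative_linear[OF deriv[OF that]]]
      by (simp add: has_field_derivative_def mult_commute_abs)
    then show ?thesis
      using crit[OF that] by (simp add: DERIV_def inner_commute)
  qed
  have path: "filterlim (\<lambda>t. x0 + t *\<^sub>R d) (nhds x0) (at (0::real))"
    by (rule tendsto_eq_intros | simp)+
  have "isCont S x0"
    unfolding S_def using cont by (intro continuous_intros) auto
  then have S0: "((\<lambda>t. S (x0 + t *\<^sub>R d)) \<longlongrightarrow> 0) (at (0::real))"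
    using isCont_tendsto_compose[OF _ path, of S] stat by (simp add: S_def)
  have "((\<lambda>t. (d \<bullet> S (x0 + t *\<^sub>R d)) / t) \<longlongrightarrow> d \<bullet> (\<Sum>k\<in>I. u k *\<^sub>R a' k d)) (at (0::real))"
  proof -
    have "((\<lambda>t. \<Sum>k\<in>I. u k * ((d \<bullet> a k (x0 + t *\<^sub>R d)) / t)) \<longlongrightarrow> (\<Sum>k\<in>I. u k * (d \<bullet> a' k d)))
        (at (0::real))"
      using line by (intro tendsto_intros) auto
    then show ?thesis
      by (simp add: S_def inner_sum_right sum_divide_distrib)
  qed
  moreover have "((\<lambda>t. (d \<bullet> S (x0 + t *\<^sub>R d)) / t) \<longlongrightarrow> 0) (at (0::real))"
  proof (rule Lim_null_comparison)
    show "\<forall>\<^sub>F t in at 0. norm ((d \<bullet> S (x0 + t *\<^sub>R d)) / t) \<le>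
        K * norm (S (x0 + t *\<^sub>R d)) * (\<Sum>k\<in>B. \<bar>(d \<bullet> a k (x0 + t *\<^sub>R d)) / t\<bar>)"
      using eventually_compose_filterlim[OF near path]
    proof eventually_elim
      case (elim t)
      then have "\<bar>d \<bullet> S (x0 + t *\<^sub>R d)\<bar> / \<bar>t\<bar> \<le>
          K * norm (S (x0 + t *\<^sub>R d)) * (\<Sum>k\<in>B. \<bar>d \<bullet> a k (x0 + t *\<^sub>R d)\<bar>) / \<bar>t\<bar>"
        by (rule divide_right_mono) simp
      then show ?case by (simp add: sum_divide_distrib[symmetric])
    qed
    have "((\<lambda>t. K * norm (S (x0 + t *\<^sub>R d)) * (\<Sum>k\<in>B. \<bar>(d \<bullet> a k (x0 + t *\<^sub>R d)) / t\<bar>)) \<longlongrightarrow>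
        K * norm (0::'a) * (\<Sum>k\<in>B. \<bar>d \<bullet> a' k d\<bar>)) (at (0::real))"
      using line S0 B(1) by (intro tendsto_intros) auto
    then show "((\<lambda>t. K * norm (S (x0 + t *\<^sub>R d)) * (\<Sum>k\<in>B. \<bar>(d \<bullet> a k (x0 + t *\<^sub>R d)) / t\<bar>)) \<longlongrightarrow> 0)
        (at (0::real))" by simp
  qed
  ultimately show ?thesis
    using LIM_unique by blast
qed

section \<open>Quasi-normality and error bounds for constraint systems\<close>

text \<open>
  A system consists of constraints \<open>c k\<close> with \<open>k \<in> I\<close>. Those with \<open>k \<in> A\<close> are inequalities
  \<open>c k x \<le> 0\<close>, the others are equations \<open>c k x = 0\<close>.
\<close>

definition violation :: "'k set \<Rightarrow> ('k \<Rightarrow> 'a \<Rightarrow> real) \<Rightarrow> 'k \<Rightarrow> 'a \<Rightarrow> real" where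
  "violation A c k x = (if k \<in> A then max (c k x) 0 else c k x)"

definition residual :: "'k set \<Rightarrow> 'k set \<Rightarrow> ('k \<Rightarrow> 'a \<Rightarrow> real) \<Rightarrow> 'a \<Rightarrow> real" where
  "residual I A c x = sqrt (\<Sum>k\<in>I. (violation A c k x)\<^sup>2)"

definition solutions :: "'k set \<Rightarrow> 'k set \<Rightarrow> ('k \<Rightarrow> 'a \<Rightarrow> real) \<Rightarrow> 'a set" where
  "solutions I A c = {x. \<forall>k\<in>I. violation A c k x = 0}"

lemma residual_nonneg: "residual I A c x \<ge> 0"
  by (simp add: residual_def sum_nonneg)

lemma residual_eq_0_iff: "finite I \<Longrightarrow> residual I A c x = 0 \<longleftrightarrow> x \<in> solutions I A c"
  by (simp add: residual_def solutions_def sum_nonneg_eq_0_iff)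

lemma DERIV_square_positive_part:
  "((\<lambda>t::real. (max t 0)\<^sup>2) has_real_derivative 2 * max t 0) (at t)"
proof -
  consider "t > 0" | "t < 0" | "t = 0" by linarith
  then show ?thesis
  proof cases
    case 1
    have "((\<lambda>t::real. t\<^sup>2) has_real_derivative 2 * t) (at t)"
      by (auto intro!: derivative_eq_intros)
    then have "((\<lambda>t::real. (max t 0)\<^sup>2) has_real_derivative 2 * t) (at t)"
      by (rule has_field_derivative_transform_within_open[where S = "{0<..}"]) (use 1 in auto)
    then show ?thesis using 1 by simp
  next
    case 2
    have "((\<lambda>t::real. 0) has_real_derivative 0) (at t)"
      by simp
    then have "((\<lambda>t::real. (max t 0)\<^sup>2) has_real_derivative 0) (at t)"
      by (rule has_field_derivative_transform_within_open[where S = "{..<0}"]) (use 2 in auto)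
    then show ?thesis using 2 by simp
  next
    case 3
    have "((\<lambda>h::real. (max h 0)\<^sup>2 / h) \<longlongrightarrow> 0) (at 0)"
    proof (rule Lim_null_comparison)
      show "\<forall>\<^sub>F h in at 0. norm ((max h 0)\<^sup>2 / h) \<le> \<bar>h\<bar>"
        by (intro always_eventually allI) (auto simp: max_def power2_eq_square)
      show "((\<lambda>h::real. \<bar>h\<bar>) \<longlongrightarrow> 0) (at 0)"
        by (rule tendsto_eq_intros | simp)+
    qed
    then show ?thesis using 3 by (simp add: DERIV_def)
  qed
qed

lemma has_derivative_square_violation:
  fixes c :: "'k \<Rightarrow> 'a::real_inner \<Rightarrow> real"
  assumes "(c k has_derivative (\<lambda>h. h \<bullet> a)) (at x)"
  shows "((\<lambda>x. (violation A c k x)\<^sup>2) has_derivative (\<lambda>h. h \<bullet> ((2 * violation A c k x) *\<^sub>R a))) (at x)"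
proof (cases "k \<in> A")
  case True
  have "((\<lambda>x. (max (c k x) 0)\<^sup>2) has_derivative (\<lambda>h. (h \<bullet> a) * (2 * max (c k x) 0))) (at x)"
    by (rule has_derivative_compose[OF assms
          DERIV_square_positive_part[unfolded has_field_derivative_def, of "c k x"],
          THEN has_derivative_eq_rhs]) auto
  with True show ?thesis
    by (simp add: violation_def mult.commute)
next
  case False
  have "((\<lambda>x. (c k x)\<^sup>2) has_derivative (\<lambda>h. 2 * c k x * (h \<bullet> a))) (at x)"
    by (rule has_derivative_eq_rhs[OF has_derivative_power[OF assms]]) auto
  with False show ?thesis
    by (simp add: violation_def)
qed

lemma has_derivative_residual:
  fixes c :: "'k \<Rightarrow> 'a::real_inner \<Rightarrow> real"
  assumes deriv: "\<And>k. k \<in> I \<Longrightarrow> (c k has_derivative (\<lambda>h. h \<bullet> a k)) (at x)"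
    and pos: "residual I A c x > 0"
  shows "(residual I A c has_derivative
    (\<lambda>h. h \<bullet> (\<Sum>k\<in>I. (violation A c k x / residual I A c x) *\<^sub>R a k))) (at x)"
proof -
  let ?s = "\<lambda>x. \<Sum>k\<in>I. (violation A c k x)\<^sup>2"
  have s: "(?s has_derivative (\<lambda>h. \<Sum>k\<in>I. h \<bullet> ((2 * violation A c k x) *\<^sub>R a k))) (at x)"
    by (intro has_derivative_sum has_derivative_square_violation deriv)
  have "?s x > 0" using pos by (simp add: residual_def)
  from has_derivative_real_sqrt[OF this s]
  show ?thesis
    unfolding residual_def[abs_def]
    by (rule has_derivative_eq_rhs)
       (auto simp: fun_eq_iff inner_sum_right sum_distrib_left sum_divide_distrib field_simps intro!: sum.cong)
qed

text \<open>
  A point \<open>x\<close> whose residual is much smaller than its distance \<open>D\<close> to the solutions has a nearby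
  non-solution at which the residual is almost stationary. Such a point minimises the residual
  with a quadratic penalty for moving away from \<open>x\<close>. The weight \<open>\<gamma> = 4 * r x / D\<^sup>2\<close> is large enough
  to keep the minimiser \<open>z\<close> within \<open>D / 2\<close> of \<open>x\<close>, hence away from the solutions, where the
  residual is differentiable. It is also small enough that the gradient of the penalty at \<open>z\<close>,
  of norm at most \<open>\<gamma> * D\<close>, is at most \<open>4 / t\<close>.
\<close>

lemma nearly_stationary_point:
  fixes c :: "'k \<Rightarrow> 'a::euclidean_space \<Rightarrow> real"
  assumes fin: "finite I"
    and deriv: "\<And>k y. k \<in> I \<Longrightarrow> (c k has_derivative (\<lambda>h. h \<bullet> a k y)) (at y)"
    and t: "t > 0" "t * residual I A c x < infdist x (solutions I A c)"
  obtains z where "dist z x \<le> infdist x (solutions I A c) / 2" "residual I A c z > 0"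
    "norm (\<Sum>k\<in>I. (violation A c k z / residual I A c z) *\<^sub>R a k z) \<le> 4 / t"
proof -
  define r where "r = residual I A c"
  define D where "D = infdist x (solutions I A c)"
  define \<gamma> where "\<gamma> = 4 * r x / D\<^sup>2"
  have "0 \<le> t * r x"
    using t(1) residual_nonneg[of I A c x] by (simp add: r_def)
  then have D: "D > 0" "t * r x < D"
    using t(2) by (simp_all add: D_def r_def)
  have pos: "r y > 0" if "dist y x < D" for y
  proof (rule ccontr)
    assume "\<not> r y > 0"
    then have "y \<in> solutions I A c"
      using residual_nonneg[of I A c y] fin by (simp add: r_def residual_eq_0_iff[symmetric])
    then have "D \<le> dist x y" unfolding D_def by (rule infdist_le)
    then show False using that by (simp add: dist_commute)
  qed
  have rx: "r x > 0" using pos D by simp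
  then have \<gamma>: "\<gamma> > 0" using D by (simp add: \<gamma>_def)
  define \<psi> where "\<psi> y = r y + \<gamma> * ((y - x) \<bullet> (y - x))" for y
  have ccont: "continuous_on UNIV (c k)" if "k \<in> I" for k
    using deriv[OF that] has_derivative_continuous by (metis continuous_at_imp_continuous_on)
  have vcont: "continuous_on UNIV (\<lambda>y. violation A c k y)" if "k \<in> I" for k
    using ccont[OF that] by (cases "k \<in> A") (auto simp: violation_def intro!: continuous_intros)
  have rcont: "continuous_on UNIV r"
    unfolding r_def residual_def[abs_def] using vcont by (intro continuous_intros) auto
  have "continuous_on (cball x D) \<psi>"
    unfolding \<psi>_def by (intro continuous_intros continuous_on_subset[OF rcont]) auto
  then obtain z where z: "z \<in> cball x D" "\<And>y. y \<in> cball x D \<Longrightarrow> \<psi> z \<le> \<psi> y"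
    using continuous_attains_inf[of "cball x D" \<psi>] D(1) by auto
  have zD: "dist z x \<le> D / 2"
  proof -
    have "\<gamma> * (dist z x)\<^sup>2 \<le> \<psi> z"
      using residual_nonneg[of I A c z] by (simp add: \<psi>_def r_def dist_norm power2_norm_eq_inner)
    also have "\<dots> \<le> \<psi> x" using z(2) D(1) by simp
    also have "\<dots> = r x" by (simp add: \<psi>_def)
    finally have "\<gamma> * (dist z x)\<^sup>2 \<le> r x" .
    then have "(dist z x)\<^sup>2 \<le> (D / 2)\<^sup>2"
      using rx D(1) by (simp add: \<gamma>_def field_simps power2_eq_square)
    then show ?thesis using D(1) power2_le_imp_le[of "dist z x" "D / 2"] by simp
  qed
  have rz: "r z > 0" using pos[of z] zD D(1) by simp
  define G where "G = (\<Sum>k\<in>I. (violation A c k z / r z) *\<^sub>R a k z)"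
  have "(r has_derivative (\<lambda>h. h \<bullet> G)) (at z)"
    unfolding r_def G_def
    by (rule has_derivative_residual[OF deriv rz[unfolded r_def]])
  then have "(\<psi> has_derivative (\<lambda>h. h \<bullet> (G + (2 * \<gamma>) *\<^sub>R (z - x)))) (at z)"
    unfolding \<psi>_def
    by (auto intro!: derivative_eq_intros simp: inner_add_right inner_commute algebra_simps)
  then have "(\<lambda>h. h \<bullet> (G + (2 * \<gamma>) *\<^sub>R (z - x))) = (\<lambda>h. 0)"
    by (rule differential_zero_maxmin[of z "ball x D", rotated 2])
       (use z(2) zD D(1) in \<open>auto simp: dist_commute\<close>)
  then have "G + (2 * \<gamma>) *\<^sub>R (z - x) = 0"
    by (metis inner_eq_zero_iff)
  then have "G = - ((2 * \<gamma>) *\<^sub>R (z - x))"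
    by (simp add: eq_neg_iff_add_eq_0)
  then have "norm G = 2 * \<gamma> * dist z x"
    using \<gamma> by (simp add: dist_norm)
  also have "\<dots> \<le> 2 * \<gamma> * (D / 2)"
    using zD \<gamma> by (intro mult_left_mono) auto
  also have "\<dots> = 4 * (r x / D)"
    using D(1) by (simp add: \<gamma>_def power2_eq_square)
  also have "\<dots> \<le> 4 / t"
    using D t(1) by (simp add: field_simps)
  finally have "norm G \<le> 4 / t" .
  then show thesis
    using that[of z] zD rz by (simp add: D_def r_def G_def)
qed

lemma bounded_family_convergent_subsequence:
  fixes f :: "nat \<Rightarrow> 'k \<Rightarrow> 'a::heine_borel"
  assumes "finite I" "\<And>k. k \<in> I \<Longrightarrow> bounded (range (\<lambda>n. f n k))"
  obtains l and \<sigma> :: "nat \<Rightarrow> nat" where "strict_mono \<sigma>" "\<And>k. k \<in> I \<Longrightarrow> (\<lambda>n. f (\<sigma> n) k) \<longlonglongrightarrow> l k"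
proof -
  obtain l and \<sigma> :: "nat \<Rightarrow> nat" where \<sigma>: "strict_mono \<sigma>"
    "\<forall>e>0. \<forall>\<^sub>F n in sequentially. \<forall>k\<in>I. dist (f (\<sigma> n) k) (l k) < e"
    using compact_lemma_general[of I "\<lambda>g k. g k" f "\<lambda>g. g"] assms by (auto simp: image_image)
  have "(\<lambda>n. f (\<sigma> n) k) \<longlonglongrightarrow> l k" if "k \<in> I" for k
    unfolding tendsto_iff using \<sigma>(2) that by (auto elim!: eventually_mono)
  then show thesis using that \<sigma>(1) by blast
qed

text \<open>
  If there is no error bound, points with \<open>n * residual < distance\<close> exist arbitrarily close to
  \<open>x0\<close>. The nearly stationary points that belong to them converge to \<open>x0\<close>, and the normalised
  violations at these points are multipliers of Euclidean norm one. A limit \<open>u\<close> of them is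
  nonzero and satisfies the stationarity equation at \<open>x0\<close>. Every violation has the sign of its
  constraint value, so a nonzero \<open>u k\<close> eventually has the sign of \<open>c k\<close> along the sequence. Thus
  \<open>u\<close> is exactly a multiplier that quasi-normality (the assumption \<open>qn\<close>) excludes.
\<close>

lemma quasinormality_imp_error_bound:
  fixes c :: "'k \<Rightarrow> 'a::euclidean_space \<Rightarrow> real"
  assumes fin: "finite I"
    and deriv: "\<And>k y. k \<in> I \<Longrightarrow> (c k has_derivative (\<lambda>h. h \<bullet> a k y)) (at y)"
    and cont: "\<And>k. k \<in> I \<Longrightarrow> isCont (a k) x0"
    and feas: "x0 \<in> solutions I A c"
    and qn: "\<And>u z. \<lbrakk>z \<longlonglongrightarrow> x0; \<And>k. k \<in> I \<inter> A \<Longrightarrow> u k \<ge> 0; (\<Sum>k\<in>I. u k *\<^sub>R a k x0) = 0;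
        \<And>s k. k \<in> I \<Longrightarrow> u k \<noteq> 0 \<Longrightarrow> u k * c k (z s) > 0\<rbrakk> \<Longrightarrow> \<forall>k\<in>I. u k = 0"
  shows "\<exists>\<alpha>>0. \<forall>\<^sub>F x in nhds x0. infdist x (solutions I A c) \<le> \<alpha> * residual I A c x"
proof (rule ccontr)
  assume contra: "\<not> ?thesis"
  let ?F = "solutions I A c" and ?r = "residual I A c" and ?v = "violation A c"
  have "\<exists>z. dist z x0 < 2 / Suc n \<and> ?r z > 0 \<and>
      norm (\<Sum>k\<in>I. (?v k z / ?r z) *\<^sub>R a k z) \<le> 4 / Suc n" for n
  proof -
    have large: "\<not> (\<forall>\<^sub>F x in nhds x0. infdist x ?F \<le> real (Suc n) * ?r x)"
      using contra by (metis of_nat_0_less_iff zero_less_Suc)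
    have "\<exists>x. dist x x0 < 1 / Suc n \<and> real (Suc n) * ?r x < infdist x ?F"
    proof (rule ccontr)
      assume "\<nexists>x. dist x x0 < 1 / Suc n \<and> real (Suc n) * ?r x < infdist x ?F"
      then have "\<forall>x. dist x x0 < 1 / Suc n \<longrightarrow> infdist x ?F \<le> real (Suc n) * ?r x"
        by (meson not_le)
      moreover have "0 < 1 / real (Suc n)" by simp
      ultimately have "\<forall>\<^sub>F x in nhds x0. infdist x ?F \<le> real (Suc n) * ?r x"
        unfolding eventually_nhds_metric by blast
      with large show False by blast
    qed
    then obtain x where x: "dist x x0 < 1 / Suc n" "real (Suc n) * ?r x < infdist x ?F"
      by blast
    obtain z where z: "dist z x \<le> infdist x ?F / 2" "?r z > 0"
      "norm (\<Sum>k\<in>I. (?v k z / ?r z) *\<^sub>R a k z) \<le> 4 / Suc n"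
      by (rule nearly_stationary_point[OF fin, of c a "real (Suc n)" A x])
         (rule x(2) | erule deriv | simp only: of_nat_0_less_iff zero_less_Suc | blast)+
    have "infdist x ?F \<le> dist x x0"
      using feas by (rule infdist_le)
    then have "dist z x0 < 2 * (1 / Suc n)"
      using z(1) x(1) dist_triangle[of z x0 x] zero_le_dist[of x x0] by linarith
    then show ?thesis using z(2,3) by auto
  qed
  then have "\<exists>z. \<forall>n. dist (z n) x0 < 2 / Suc n \<and> ?r (z n) > 0 \<and>
      norm (\<Sum>k\<in>I. (?v k (z n) / ?r (z n)) *\<^sub>R a k (z n)) \<le> 4 / Suc n"
    by (intro choice allI)
  then obtain z where z: "\<And>n. dist (z n) x0 < 2 / Suc n" "\<And>n. ?r (z n) > 0"
      "\<And>n. norm (\<Sum>k\<in>I. (?v k (z n) / ?r (z n)) *\<^sub>R a k (z n)) \<le> 4 / Suc n"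
    by blast
  define w where "w n k = ?v k (z n) / ?r (z n)" for n k
  have unit: "(\<Sum>k\<in>I. (w n k)\<^sup>2) = 1" for n
  proof -
    have "(\<Sum>k\<in>I. (?v k (z n))\<^sup>2) = (?r (z n))\<^sup>2"
      by (simp add: residual_def sum_nonneg)
    then show ?thesis
      using z(2)[of n] by (simp add: w_def power_divide sum_divide_distrib[symmetric])
  qed
  have "bounded (range (\<lambda>n. w n k))" if "k \<in> I" for k
  proof -
    have "(w n k)\<^sup>2 \<le> 1" for n
      using member_le_sum[OF that, of "\<lambda>k. (w n k)\<^sup>2"] fin unit by simp
    then have "\<forall>y\<in>range (\<lambda>n. w n k). norm y \<le> 1"
      by (auto simp: abs_square_le_1)
    then show ?thesis unfolding bounded_iff by blast
  qed
  then obtain u and \<sigma> :: "nat \<Rightarrow> nat" where \<sigma>: "strict_mono \<sigma>"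
    and u: "\<And>k. k \<in> I \<Longrightarrow> (\<lambda>n. w (\<sigma> n) k) \<longlonglongrightarrow> u k"
    using bounded_family_convergent_subsequence[OF fin, of w] by blast
  have inv: "(\<lambda>n. C / real (Suc n)) \<longlonglongrightarrow> 0" for C
    using LIMSEQ_Suc[OF lim_const_over_n] by simp
  have "z \<longlonglongrightarrow> x0"
  proof (rule tendsto_dist_iff[THEN iffD2], rule Lim_null_comparison[OF always_eventually inv[of 2]], rule allI)
    show "norm (dist (z n) x0) \<le> 2 / real (Suc n)" for n
      using z(1)[of n] by simp
  qed
  then have z_lim: "(\<lambda>n. z (\<sigma> n)) \<longlonglongrightarrow> x0"
    using LIMSEQ_subseq_LIMSEQ[OF _ \<sigma>] by (simp add: o_def)
  have sign: "\<forall>\<^sub>F n in sequentially. u k * c k (z (\<sigma> n)) > 0" if k: "k \<in> I" "u k \<noteq> 0" for k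
  proof -
    have "(\<lambda>n. u k * w (\<sigma> n) k) \<longlonglongrightarrow> u k * u k"
      using u[OF k(1)] by (intro tendsto_intros)
    moreover have "u k * u k > 0"
      using k(2) by (auto simp: zero_less_mult_iff)
    ultimately have "\<forall>\<^sub>F n in sequentially. u k * w (\<sigma> n) k > 0"
      by (rule order_tendstoD(1))
    then show ?thesis
    proof eventually_elim
      case (elim n)
      then have "u k * ?v k (z (\<sigma> n)) > 0"
        using z(2)[of "\<sigma> n"] by (simp add: w_def zero_less_divide_iff)
      then show ?case
        by (auto simp: violation_def max_def split: if_splits)
    qed
  qed
  have "\<forall>\<^sub>F n in sequentially. \<forall>k\<in>{k\<in>I. u k \<noteq> 0}. u k * c k (z (\<sigma> n)) > 0"
    using sign fin by (intro eventually_ball_finite) auto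
  then obtain N where N: "\<And>n k. n \<ge> N \<Longrightarrow> k \<in> I \<Longrightarrow> u k \<noteq> 0 \<Longrightarrow> u k * c k (z (\<sigma> n)) > 0"
    by (auto simp: eventually_sequentially)
  have "\<forall>k\<in>I. u k = 0"
  proof (rule qn)
    show "(\<lambda>s. z (\<sigma> (s + N))) \<longlonglongrightarrow> x0"
      using z_lim by (rule LIMSEQ_ignore_initial_segment)
    show "u k \<ge> 0" if "k \<in> I \<inter> A" for k
    proof (rule LIMSEQ_le_const[OF u])
      show "\<exists>N. \<forall>n\<ge>N. 0 \<le> w (\<sigma> n) k"
        using that z(2) by (auto simp: w_def violation_def intro!: divide_nonneg_pos)
    qed (use that in auto)
    show "(\<Sum>k\<in>I. u k *\<^sub>R a k x0) = 0"
    proof (rule LIMSEQ_unique)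
      show "(\<lambda>n. \<Sum>k\<in>I. w (\<sigma> n) k *\<^sub>R a k (z (\<sigma> n))) \<longlonglongrightarrow> (\<Sum>k\<in>I. u k *\<^sub>R a k x0)"
        using u isCont_tendsto_compose[OF cont z_lim] by (intro tendsto_intros) auto
      have "(\<lambda>n. \<Sum>k\<in>I. w n k *\<^sub>R a k (z n)) \<longlonglongrightarrow> 0"
        by (rule Lim_null_comparison[OF always_eventually inv[of 4]]) (simp only: w_def z(3) simp_thms)
      then show "(\<lambda>n. \<Sum>k\<in>I. w (\<sigma> n) k *\<^sub>R a k (z (\<sigma> n))) \<longlonglongrightarrow> 0"
        using LIMSEQ_subseq_LIMSEQ[OF _ \<sigma>] by (simp add: o_def)
    qed
    show "u k * c k (z (\<sigma> (s + N))) > 0" if "k \<in> I" "u k \<noteq> 0" for s k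
      using N that by simp
  qed
  moreover have "(\<Sum>k\<in>I. (u k)\<^sup>2) = 1"
  proof (rule LIMSEQ_unique)
    show "(\<lambda>n. \<Sum>k\<in>I. (w (\<sigma> n) k)\<^sup>2) \<longlonglongrightarrow> (\<Sum>k\<in>I. (u k)\<^sup>2)"
      using u by (intro tendsto_intros) auto
  qed (simp add: unit)
  ultimately show False by simp
qed

section \<open>Gradients and Hessians\<close>

lemma has_derivative_gradient:
  fixes f :: "real ^ 'n \<Rightarrow> real"
  assumes "f differentiable (at x)"
  shows "(f has_derivative (\<lambda>h. h \<bullet> gradient f x)) (at x)"
proof -
  obtain f' where f': "(f has_derivative f') (at x)"
    using assms by (auto simp: differentiable_def)
  have "f' h = h \<bullet> adjoint f' 1" for h
    using adjoint_works[OF has_derivative_linear[OF f'], of h 1] by simp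
  then have "f' = (\<lambda>h. h \<bullet> adjoint f' 1)"
    by (rule ext)
  then have ex: "GDERIV f x :> adjoint f' 1"
    unfolding gderiv_def by (rule has_derivative_eq_rhs[OF f'])
  have "D = adjoint f' 1" if "GDERIV f x :> D" for D
  proof -
    have "(\<lambda>h. h \<bullet> D) = (\<lambda>h. h \<bullet> adjoint f' 1)"
      using that ex has_derivative_unique by (auto simp: gderiv_def)
    then show ?thesis
      by (metis inner_commute vector_eq_rdot)
  qed
  then have "gradient f x = adjoint f' 1"
    unfolding gradient_def using ex by (intro the_equality)
  then show ?thesis using ex by (simp add: gderiv_def)
qed

lemma has_derivative_hessian:
  fixes f :: "real ^ 'n \<Rightarrow> real"
  assumes "gradient f differentiable (at x)"
  shows "(gradient f has_derivative (\<lambda>h. hessian f x *v h)) (at x)"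
proof -
  have D: "(gradient f has_derivative frechet_derivative (gradient f) (at x)) (at x)"
    using assms by (simp add: frechet_derivative_works)
  then have "hessian f x *v h = frechet_derivative (gradient f) (at x) h" for h
    unfolding hessian_def by (simp add: matrix_works has_derivative_linear)
  then show ?thesis using D by simp
qed

section \<open>The branches of a switching program\<close>

text \<open>
  The four kinds of constraints of a switching program get one common index type, so that the
  results on constraint systems apply to a branch, in which the chosen factor of every switching
  constraint is an equation.
\<close>

datatype constraint = Ineq nat | Eq nat | Switch_G nat | Switch_H nat

primrec constraint_fun :: "('n :: finite) mpsc \<Rightarrow> constraint \<Rightarrow> real ^ 'n \<Rightarrow> real" where
  "constraint_fun P (Ineq i) = con_g P i"
| "constraint_fun P (Eq j) = con_h P j"
| "constraint_fun P (Switch_G k) = sw_G P k"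
| "constraint_fun P (Switch_H k) = sw_H P k"

definition constraints :: "nat set \<Rightarrow> nat set \<Rightarrow> nat set \<Rightarrow> nat set \<Rightarrow> constraint set" where
  "constraints I J K L = Ineq ` I \<union> Eq ` J \<union> Switch_G ` K \<union> Switch_H ` L"

lemma finite_constraints:
  "finite I \<Longrightarrow> finite J \<Longrightarrow> finite K \<Longrightarrow> finite L \<Longrightarrow> finite (constraints I J K L)"
  by (simp add: constraints_def)

lemma ball_constraints:
  "(\<forall>k\<in>constraints I J K L. Q k) \<longleftrightarrow>
    (\<forall>i\<in>I. Q (Ineq i)) \<and> (\<forall>j\<in>J. Q (Eq j)) \<and> (\<forall>k\<in>K. Q (Switch_G k)) \<and> (\<forall>k\<in>L. Q (Switch_H k))"
  by (auto simp: constraints_def)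

lemma sum_constraints:
  assumes "finite I" "finite J" "finite K" "finite L"
  shows "sum f (constraints I J K L) =
    (\<Sum>i\<in>I. f (Ineq i)) + (\<Sum>j\<in>J. f (Eq j)) + (\<Sum>k\<in>K. f (Switch_G k)) + (\<Sum>k\<in>L. f (Switch_H k))"
  unfolding constraints_def using assms
  by (subst sum.union_disjoint; (auto simp: sum.reindex inj_on_def)[1])+

abbreviation branch_constraints ::
  "('n :: finite) mpsc \<Rightarrow> real ^ 'n \<Rightarrow> nat set \<Rightarrow> nat set \<Rightarrow> constraint set" where
  "branch_constraints P xbar \<beta>1 \<beta>2 \<equiv>
     constraints {1..num_g P} {1..num_h P} (idx_G P xbar \<union> \<beta>1) (idx_H P xbar \<union> \<beta>2)"

abbreviation branch_feasible ::
  "('n :: finite) mpsc \<Rightarrow> real ^ 'n \<Rightarrow> nat set \<Rightarrow> nat set \<Rightarrow> (real ^ 'n) set" where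
  "branch_feasible P xbar \<beta>1 \<beta>2 \<equiv>
     solutions (branch_constraints P xbar \<beta>1 \<beta>2) (range Ineq) (constraint_fun P)"

abbreviation branch_residual ::
  "('n :: finite) mpsc \<Rightarrow> real ^ 'n \<Rightarrow> nat set \<Rightarrow> nat set \<Rightarrow> real ^ 'n \<Rightarrow> real" where
  "branch_residual P xbar \<beta>1 \<beta>2 \<equiv>
     residual (branch_constraints P xbar \<beta>1 \<beta>2) (range Ineq) (constraint_fun P)"

lemma violation_constraint [simp]:
  "violation (range Ineq) c (Ineq i) x = max (c (Ineq i) x) 0"
  "violation (range Ineq) c (Eq i) x = c (Eq i) x"
  "violation (range Ineq) c (Switch_G i) x = c (Switch_G i) x"
  "violation (range Ineq) c (Switch_H i) x = c (Switch_H i) x"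
  by (auto simp: violation_def)

lemma bipartition_finite:
  assumes "(\<beta>1, \<beta>2) \<in> bipartitions (idx_GH P xbar)"
  shows "finite (idx_G P xbar \<union> \<beta>1)" "finite (idx_H P xbar \<union> \<beta>2)"
    "idx_G P xbar \<union> \<beta>1 \<subseteq> {1..num_sw P}" "idx_H P xbar \<union> \<beta>2 \<subseteq> {1..num_sw P}"
proof -
  show *: "idx_G P xbar \<union> \<beta>1 \<subseteq> {1..num_sw P}" "idx_H P xbar \<union> \<beta>2 \<subseteq> {1..num_sw P}"
    using assms by (auto simp: bipartitions_def idx_G_def idx_H_def idx_GH_def)
  show "finite (idx_G P xbar \<union> \<beta>1)" "finite (idx_H P xbar \<union> \<beta>2)"
    using *[THEN finite_subset] by auto
qed

lemma branch_feasible_subset: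
  assumes feas: "xbar \<in> feasible_set P"
    and part: "(\<beta>1, \<beta>2) \<in> bipartitions (idx_GH P xbar)"
  shows "branch_feasible P xbar \<beta>1 \<beta>2 \<subseteq> feasible_set P"
proof
  fix x assume "x \<in> branch_feasible P xbar \<beta>1 \<beta>2"
  then have x: "\<forall>i\<in>{1..num_g P}. con_g P i x \<le> 0" "\<forall>j\<in>{1..num_h P}. con_h P j x = 0"
    "\<forall>k\<in>idx_G P xbar \<union> \<beta>1. sw_G P k x = 0" "\<forall>k\<in>idx_H P xbar \<union> \<beta>2. sw_H P k x = 0"
    by (auto simp: solutions_def ball_constraints max_def split: if_splits)
  have "sw_G P k x * sw_H P k x = 0" if "k \<in> {1..num_sw P}" for k
  proof -
    have "k \<in> idx_G P xbar \<union> idx_H P xbar \<union> idx_GH P xbar"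
      using that feas by (auto simp: feasible_set_def idx_G_def idx_H_def idx_GH_def)
    then have "k \<in> idx_G P xbar \<union> \<beta>1 \<or> k \<in> idx_H P xbar \<union> \<beta>2"
      using part by (auto simp: bipartitions_def)
    then show ?thesis using x(3,4) by auto
  qed
  then show "x \<in> feasible_set P"
    using x(1,2) by (simp add: feasible_set_def)
qed

lemma base_point_branch_feasible:
  assumes "xbar \<in> feasible_set P" "(\<beta>1, \<beta>2) \<in> bipartitions (idx_GH P xbar)"
  shows "xbar \<in> branch_feasible P xbar \<beta>1 \<beta>2"
  using assms by (auto simp: solutions_def ball_constraints feasible_set_def bipartitions_def
      idx_G_def idx_H_def idx_GH_def)

lemma constraint_twice_continuously_differentiable:
  assumes "c2_mpsc P" "(\<beta>1, \<beta>2) \<in> bipartitions (idx_GH P xbar)"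
    "k \<in> branch_constraints P xbar \<beta>1 \<beta>2"
  shows "twice_continuously_differentiable (constraint_fun P k)"
  using assms(1,3) bipartition_finite(3,4)[OF assms(2)]
  by (auto simp: constraints_def c2_mpsc_def subset_eq)

text \<open>
  Second-order quasi-normality and constant rank together give ordinary quasi-normality of the
  branch. A multiplier \<open>u\<close> as in the assumptions vanishes at inactive inequalities, because a
  positive weight would need points near \<open>xbar\<close> at which the constraint is positive. So \<open>u\<close> is
  a relation between the gradients in the constant rank family, and its Hessian form vanishes on
  the critical subspace by \<open>constant_rank_curvature_zero\<close>. The second-order inequality in the
  definition of a multiplier therefore holds for free, and \<open>u\<close> must be zero.
\<close>

lemma branch_quasinormality:
  fixes P :: "('n :: finite) mpsc"
  assumes c2: "c2_mpsc P" and pwcr: "mpsc_pwcr P xbar" and psoqn: "mpsc_psoqn P xbar"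
    and feas: "xbar \<in> feasible_set P"
    and part: "(\<beta>1, \<beta>2) \<in> bipartitions (idx_GH P xbar)"
    and z: "z \<longlonglongrightarrow> xbar"
    and nonneg: "\<And>i. i \<in> {1..num_g P} \<Longrightarrow> u (Ineq i) \<ge> 0"
    and stat: "(\<Sum>k\<in>branch_constraints P xbar \<beta>1 \<beta>2. u k *\<^sub>R gradient (constraint_fun P k) xbar) = 0"
    and sign: "\<And>s k. k \<in> branch_constraints P xbar \<beta>1 \<beta>2 \<Longrightarrow> u k \<noteq> 0 \<Longrightarrow>
        u k * constraint_fun P k (z s) > 0"
  shows "\<forall>k\<in>branch_constraints P xbar \<beta>1 \<beta>2. u k = 0"
proof (rule ccontr)
  assume nonzero: "\<not> ?thesis"
  let ?I = "branch_constraints P xbar \<beta>1 \<beta>2"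
  let ?K = "idx_G P xbar \<union> \<beta>1" and ?L = "idx_H P xbar \<union> \<beta>2"
  \<comment> \<open>the constraints whose gradients enter the rank condition: only active inequalities\<close>
  define J where "J = constraints (idx_g P xbar) (idx_h P) ?K ?L"
  note finKL = bipartition_finite(1,2)[OF part]
  have finJ: "finite J"
    unfolding J_def using finKL by (intro finite_constraints) (auto simp: idx_g_def idx_h_def)
  have finI: "finite ?I"
    using finKL by (intro finite_constraints) auto
  have JI: "J \<subseteq> ?I"
    by (auto simp: J_def constraints_def idx_g_def idx_h_def)
  note smooth = constraint_twice_continuously_differentiable[OF c2 part]
  have inactive: "u k = 0" if k: "k \<in> ?I - J" for k
  proof (rule ccontr)
    assume uk: "u k \<noteq> 0"
    obtain i where i: "k = Ineq i" "i \<in> {1..num_g P}" "con_g P i xbar \<noteq> 0"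
      using k by (force simp: J_def constraints_def idx_g_def idx_h_def)
    have "isCont (constraint_fun P k) xbar"
      using smooth[of k] that
      by (auto simp: twice_continuously_differentiable_def intro!: differentiable_imp_continuous_within)
    then have lim: "(\<lambda>s. constraint_fun P k (z s)) \<longlonglongrightarrow> con_g P i xbar"
      using isCont_tendsto_compose[OF _ z] i(1) by fastforce
    have "u k > 0" using nonneg[OF i(2)] uk i(1) by simp
    then have "0 \<le> constraint_fun P k (z s)" for s
      using sign[of k s] that uk by (simp add: zero_less_mult_iff)
    then have "0 \<le> con_g P i xbar"
      using LIMSEQ_le_const[OF lim] by blast
    then show False
      using i(2,3) feas by (force simp: feasible_set_def)
  qed
  have curvature: "d \<bullet> (\<Sum>k\<in>?I. u k *\<^sub>R (hessian (constraint_fun P k) xbar *v d)) = 0"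
    if d: "d \<in> critical_subspace P xbar \<beta>1 \<beta>2" for d
  proof -
    obtain r where rank: "\<forall>\<^sub>F x in nhds xbar. dim (branch_gradients P xbar \<beta>1 \<beta>2 x) = r"
      using pwcr part by (fastforce simp: mpsc_pwcr_def eventually_nhds_metric dist_norm)
    have "branch_gradients P xbar \<beta>1 \<beta>2 x = (\<lambda>k. gradient (constraint_fun P k) x) ` J" for x
      by (simp add: branch_gradients_def J_def constraints_def image_Un image_image)
    then have rankJ: "\<forall>\<^sub>F x in nhds xbar. dim ((\<lambda>k. gradient (constraint_fun P k) x) ` J) = r"
      using rank by simp
    have derivJ: "(gradient (constraint_fun P k) has_derivative
        (\<lambda>h. hessian (constraint_fun P k) xbar *v h)) (at xbar)" if "k \<in> J" for k
      using smooth[of k] that JI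
      by (auto simp: twice_continuously_differentiable_def intro!: has_derivative_hessian)
    have statJ: "(\<Sum>k\<in>J. u k *\<^sub>R gradient (constraint_fun P k) xbar) = 0"
    proof -
      have "(\<Sum>k\<in>J. u k *\<^sub>R gradient (constraint_fun P k) xbar) =
          (\<Sum>k\<in>?I. u k *\<^sub>R gradient (constraint_fun P k) xbar)"
        using finI JI inactive by (intro sum.mono_neutral_left) auto
      then show ?thesis using stat by simp
    qed
    have "\<forall>k\<in>J. gradient (constraint_fun P k) xbar \<bullet> d = 0"
      using d by (simp add: J_def ball_constraints critical_subspace_def)
    then have "d \<bullet> (\<Sum>k\<in>J. u k *\<^sub>R (hessian (constraint_fun P k) xbar *v d)) = 0"
      using constant_rank_curvature_zero[OF finJ derivJ rankJ statJ] by blast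
    also have "(\<Sum>k\<in>J. u k *\<^sub>R (hessian (constraint_fun P k) xbar *v d)) =
        (\<Sum>k\<in>?I. u k *\<^sub>R (hessian (constraint_fun P k) xbar *v d))"
      using finI JI inactive by (intro sum.mono_neutral_left) auto
    finally show ?thesis .
  qed
  have matrix_sum: "(\<Sum>i\<in>S. w i *\<^sub>R M i) *v d = (\<Sum>i\<in>S. w i *\<^sub>R (M i *v d))"
    if "finite S" for S :: "nat set" and w and M :: "nat \<Rightarrow> real ^ 'n ^ 'n" and d
    using that by (induction S) (simp_all add: matrix_vector_mult_add_rdistrib scaleR_matrix_vector_assoc)
  have "psoqn_multiplier P xbar \<beta>1 \<beta>2 (\<lambda>i. u (Ineq i)) (\<lambda>j. u (Eq j))
      (\<lambda>k. u (Switch_G k)) (\<lambda>k. u (Switch_H k))"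
    unfolding psoqn_multiplier_def
  proof (intro conjI ballI)
    show "(\<exists>i\<in>{1..num_g P}. u (Ineq i) \<noteq> 0) \<or> (\<exists>j\<in>{1..num_h P}. u (Eq j) \<noteq> 0) \<or>
      (\<exists>k\<in>?K. u (Switch_G k) \<noteq> 0) \<or> (\<exists>k\<in>?L. u (Switch_H k) \<noteq> 0)"
      using nonzero unfolding ball_constraints by blast
    show "(\<Sum>i = 1..num_g P. u (Ineq i) *\<^sub>R gradient (con_g P i) xbar) +
        (\<Sum>j = 1..num_h P. u (Eq j) *\<^sub>R gradient (con_h P j) xbar) +
        (\<Sum>k\<in>?K. u (Switch_G k) *\<^sub>R gradient (sw_G P k) xbar) +
        (\<Sum>k\<in>?L. u (Switch_H k) *\<^sub>R gradient (sw_H P k) xbar) = 0"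
      using stat finKL by (simp add: sum_constraints)
    show "0 \<le> d \<bullet> (((\<Sum>i = 1..num_g P. u (Ineq i) *\<^sub>R hessian (con_g P i) xbar) +
        (\<Sum>j = 1..num_h P. u (Eq j) *\<^sub>R hessian (con_h P j) xbar) +
        (\<Sum>k\<in>?K. u (Switch_G k) *\<^sub>R hessian (sw_G P k) xbar) +
        (\<Sum>k\<in>?L. u (Switch_H k) *\<^sub>R hessian (sw_H P k) xbar)) *v d)"
      if "d \<in> critical_subspace P xbar \<beta>1 \<beta>2" for d
      using curvature[OF that] finKL
      by (simp add: sum_constraints matrix_vector_mult_add_rdistrib matrix_sum)
    show "\<exists>xs. xs \<longlonglongrightarrow> xbar \<and>
        (\<forall>s::nat. (\<forall>i\<in>{1..num_g P}. 0 < u (Ineq i) \<longrightarrow> 0 < u (Ineq i) * con_g P i (xs s)) \<and>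
          (\<forall>j\<in>{1..num_h P}. u (Eq j) \<noteq> 0 \<longrightarrow> 0 < u (Eq j) * con_h P j (xs s)) \<and>
          (\<forall>k\<in>?K. u (Switch_G k) \<noteq> 0 \<longrightarrow> 0 < u (Switch_G k) * sw_G P k (xs s)) \<and>
          (\<forall>k\<in>?L. u (Switch_H k) \<noteq> 0 \<longrightarrow> 0 < u (Switch_H k) * sw_H P k (xs s)))"
    proof (intro exI[of _ z] conjI allI z)
      fix s
      have "\<forall>k\<in>?I. u k \<noteq> 0 \<longrightarrow> 0 < u k * constraint_fun P k (z s)"
        using sign by blast
      note * = this[unfolded ball_constraints constraint_fun.simps]
      show "\<forall>i\<in>{1..num_g P}. 0 < u (Ineq i) \<longrightarrow> 0 < u (Ineq i) * con_g P i (z s)"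
        using * by (metis less_irrefl)
      show "\<forall>j\<in>{1..num_h P}. u (Eq j) \<noteq> 0 \<longrightarrow> 0 < u (Eq j) * con_h P j (z s)"
        "\<forall>k\<in>?K. u (Switch_G k) \<noteq> 0 \<longrightarrow> 0 < u (Switch_G k) * sw_G P k (z s)"
        "\<forall>k\<in>?L. u (Switch_H k) \<noteq> 0 \<longrightarrow> 0 < u (Switch_H k) * sw_H P k (z s)"
        using * by blast+
    qed
  qed (use nonneg in auto)
  then show False
    using psoqn part by (auto simp: mpsc_psoqn_def)
qed

lemma branch_error_bound:
  assumes c2: "c2_mpsc P" and pwcr: "mpsc_pwcr P xbar" and psoqn: "mpsc_psoqn P xbar"
    and feas: "xbar \<in> feasible_set P"
    and part: "(\<beta>1, \<beta>2) \<in> bipartitions (idx_GH P xbar)"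
  shows "\<exists>\<alpha>>0. \<forall>\<^sub>F x in nhds xbar. infdist x (feasible_set P) \<le> \<alpha> * branch_residual P xbar \<beta>1 \<beta>2 x"
proof -
  note smooth = constraint_twice_continuously_differentiable[OF c2 part]
  have "\<exists>\<alpha>>0. \<forall>\<^sub>F x in nhds xbar.
      infdist x (branch_feasible P xbar \<beta>1 \<beta>2) \<le> \<alpha> * branch_residual P xbar \<beta>1 \<beta>2 x"
  proof (rule quasinormality_imp_error_bound)
    show "finite (branch_constraints P xbar \<beta>1 \<beta>2)"
      using bipartition_finite(1,2)[OF part] by (intro finite_constraints) auto
    show "(constraint_fun P k has_derivative (\<lambda>h. h \<bullet> gradient (constraint_fun P k) y)) (at y)"
      if "k \<in> branch_constraints P xbar \<beta>1 \<beta>2" for k y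
      using smooth[OF that] by (auto simp: twice_continuously_differentiable_def intro!: has_derivative_gradient)
    show "isCont (gradient (constraint_fun P k)) xbar"
      if "k \<in> branch_constraints P xbar \<beta>1 \<beta>2" for k
      using smooth[OF that]
      by (auto simp: twice_continuously_differentiable_def intro!: differentiable_imp_continuous_within)
    show "xbar \<in> branch_feasible P xbar \<beta>1 \<beta>2"
      by (rule base_point_branch_feasible[OF feas part])
    fix u :: "constraint \<Rightarrow> real" and z
    assume "z \<longlonglongrightarrow> xbar"
      and nonneg: "\<And>k. k \<in> branch_constraints P xbar \<beta>1 \<beta>2 \<inter> range Ineq \<Longrightarrow> 0 \<le> u k"
      and "(\<Sum>k\<in>branch_constraints P xbar \<beta>1 \<beta>2. u k *\<^sub>R gradient (constraint_fun P k) xbar) = 0"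
      and "\<And>s k. k \<in> branch_constraints P xbar \<beta>1 \<beta>2 \<Longrightarrow> u k \<noteq> 0 \<Longrightarrow>
        u k * constraint_fun P k (z s) > 0"
    moreover have "0 \<le> u (Ineq i)" if "i \<in> {1..num_g P}" for i
      using nonneg[of "Ineq i"] that by (simp add: constraints_def)
    ultimately show "\<forall>k\<in>branch_constraints P xbar \<beta>1 \<beta>2. u k = 0"
      by (intro branch_quasinormality[OF c2 pwcr psoqn feas part])
  qed
  then obtain \<alpha> where \<alpha>: "\<alpha> > 0" "\<forall>\<^sub>F x in nhds xbar.
      infdist x (branch_feasible P xbar \<beta>1 \<beta>2) \<le> \<alpha> * branch_residual P xbar \<beta>1 \<beta>2 x"
    by blast
  have "infdist x (feasible_set P) \<le> infdist x (branch_feasible P xbar \<beta>1 \<beta>2)" for x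
    using branch_feasible_subset[OF feas part] base_point_branch_feasible[OF feas part]
    by (intro infdist_mono) auto
  then show ?thesis
    using \<alpha> by (intro exI[of _ \<alpha>]) (auto elim!: eventually_mono intro: order_trans)
qed

section \<open>Gluing the branches\<close>

definition mpsc_residual :: "('n :: finite) mpsc \<Rightarrow> real ^ 'n \<Rightarrow> real" where
  "mpsc_residual P x = sqrt ((\<Sum>i=1..num_g P. (max (con_g P i x) 0)\<^sup>2) +
     (\<Sum>j=1..num_h P. (con_h P j x)\<^sup>2) +
     (\<Sum>k=1..num_sw P. min ((sw_G P k x)\<^sup>2) ((sw_H P k x)\<^sup>2)))"

text \<open>
  For a given \<open>x\<close> the right branch demands, for each biactive pair, that the factor of smaller
  absolute value at \<open>x\<close> be zero. A pair that is not biactive has one factor that stays away from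
  zero near \<open>xbar\<close>, so there too the minimum is attained by the factor that the branch sets to
  zero.
\<close>

lemma eventually_branch_residual_eq:
  fixes P :: "('n :: finite) mpsc"
  assumes c2: "c2_mpsc P" and feas: "xbar \<in> feasible_set P"
  shows "\<forall>\<^sub>F x in nhds xbar. \<exists>(\<beta>1, \<beta>2) \<in> bipartitions (idx_GH P xbar).
    branch_residual P xbar \<beta>1 \<beta>2 x = mpsc_residual P x"
proof -
  have cont: "isCont (sw_G P k) xbar" "isCont (sw_H P k) xbar" if "k \<in> {1..num_sw P}" for k
    using c2 that by (auto simp: c2_mpsc_def twice_continuously_differentiable_def
        intro!: differentiable_imp_continuous_within)
  have ev: "\<forall>\<^sub>F x in nhds xbar. \<bar>f x\<bar> < \<bar>g x\<bar>"
    if "isCont f xbar" "isCont g xbar" "f xbar = 0" "g xbar \<noteq> 0" for f g :: "real ^ 'n \<Rightarrow> real"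
  proof -
    have "isCont (\<lambda>x. \<bar>g x\<bar> - \<bar>f x\<bar>) xbar"
      using that by (intro continuous_intros)
    then have "((\<lambda>x. \<bar>g x\<bar> - \<bar>f x\<bar>) \<longlongrightarrow> \<bar>g xbar\<bar> - \<bar>f xbar\<bar>) (nhds xbar)"
      unfolding isCont_def by (rule tendsto_at_iff_tendsto_nhds[THEN iffD1])
    then have "\<forall>\<^sub>F x in nhds xbar. 0 < \<bar>g x\<bar> - \<bar>f x\<bar>"
      using that(3,4) by (intro order_tendstoD(1)) auto
    then show ?thesis by (rule eventually_mono) simp
  qed
  have fin: "finite (idx_G P xbar)" "finite (idx_H P xbar)" "finite (idx_GH P xbar)"
    by (simp_all add: idx_G_def idx_H_def idx_GH_def)
  have "\<forall>\<^sub>F x in nhds xbar. \<forall>k\<in>idx_G P xbar. \<bar>sw_G P k x\<bar> < \<bar>sw_H P k x\<bar>"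
    using fin(1) by (intro eventually_ball_finite ballI ev cont) (auto simp: idx_G_def)
  moreover have "\<forall>\<^sub>F x in nhds xbar. \<forall>k\<in>idx_H P xbar. \<bar>sw_H P k x\<bar> < \<bar>sw_G P k x\<bar>"
    using fin(2) by (intro eventually_ball_finite ballI ev cont) (auto simp: idx_H_def)
  ultimately show ?thesis
  proof eventually_elim
    case (elim x)
    define \<beta>1 where "\<beta>1 = {k\<in>idx_GH P xbar. \<bar>sw_G P k x\<bar> \<le> \<bar>sw_H P k x\<bar>}"
    define \<beta>2 where "\<beta>2 = idx_GH P xbar - \<beta>1"
    let ?K = "idx_G P xbar \<union> \<beta>1" and ?L = "idx_H P xbar \<union> \<beta>2"
    let ?m = "\<lambda>k. min ((sw_G P k x)\<^sup>2) ((sw_H P k x)\<^sup>2)"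
    have part: "(\<beta>1, \<beta>2) \<in> bipartitions (idx_GH P xbar)"
      by (auto simp: bipartitions_def \<beta>1_def \<beta>2_def)
    note finKL = bipartition_finite(1,2)[OF part]
    have "{1..num_sw P} = ?K \<union> ?L" "?K \<inter> ?L = {}"
      using feas by (auto simp: \<beta>1_def \<beta>2_def feasible_set_def idx_G_def idx_H_def idx_GH_def)
    then have "(\<Sum>k=1..num_sw P. ?m k) = (\<Sum>k\<in>?K. ?m k) + (\<Sum>k\<in>?L. ?m k)"
      using finKL by (simp add: sum.union_disjoint)
    also have "(\<Sum>k\<in>?K. ?m k) = (\<Sum>k\<in>?K. (sw_G P k x)\<^sup>2)"
      using elim(1) by (intro sum.cong) (auto simp: \<beta>1_def min_def abs_le_square_iff[symmetric])
    also have "(\<Sum>k\<in>?L. ?m k) = (\<Sum>k\<in>?L. (sw_H P k x)\<^sup>2)"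
      using elim(2) by (intro sum.cong) (auto simp: \<beta>1_def \<beta>2_def min_def abs_le_square_iff[symmetric])
    finally have "branch_residual P xbar \<beta>1 \<beta>2 x = mpsc_residual P x"
      using finKL by (simp add: residual_def mpsc_residual_def sum_constraints add.assoc)
    then show ?case using part by blast
  qed
qed

theorem theorem6p2:
  fixes P :: "('n :: finite) mpsc" and xbar :: "real ^ 'n"
  assumes "c2_mpsc P"
    and "xbar \<in> feasible_set P"
    and "mpsc_pwcr P xbar"
    and "mpsc_psoqn P xbar"
  shows "local_error_bound P xbar"
proof -
  let ?B = "bipartitions (idx_GH P xbar)"
  have "?B \<subseteq> Pow (idx_GH P xbar) \<times> Pow (idx_GH P xbar)"
    by (auto simp: bipartitions_def)
  then have finB: "finite ?B"
    by (rule finite_subset) (simp add: idx_GH_def)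
  have "\<forall>b\<in>?B. \<exists>\<alpha>>0. \<forall>\<^sub>F x in nhds xbar.
      infdist x (feasible_set P) \<le> \<alpha> * branch_residual P xbar (fst b) (snd b) x"
  proof
    fix b assume "b \<in> ?B"
    then show "\<exists>\<alpha>>0. \<forall>\<^sub>F x in nhds xbar.
        infdist x (feasible_set P) \<le> \<alpha> * branch_residual P xbar (fst b) (snd b) x"
      by (intro branch_error_bound[OF assms(1,3,4,2)]) simp
  qed
  from bchoice[OF this] obtain \<alpha> where \<alpha>: "\<And>b. b \<in> ?B \<Longrightarrow> \<alpha> b > 0" "\<And>b. b \<in> ?B \<Longrightarrow> \<forall>\<^sub>F x in nhds xbar.
      infdist x (feasible_set P) \<le> \<alpha> b * branch_residual P xbar (fst b) (snd b) x"
    by blast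
  define C where "C = 1 + (\<Sum>b\<in>?B. \<alpha> b)"
  have \<alpha>_le: "\<alpha> b \<le> C" if "b \<in> ?B" for b
    using member_le_sum[OF that, of \<alpha>] \<alpha>(1) finB by (force simp: C_def intro: less_imp_le)
  have "C > 0"
    unfolding C_def using \<alpha>(1) by (intro add_pos_nonneg sum_nonneg) (auto intro: less_imp_le)
  have "\<forall>\<^sub>F x in nhds xbar. \<forall>b\<in>?B.
      infdist x (feasible_set P) \<le> \<alpha> b * branch_residual P xbar (fst b) (snd b) x"
    using \<alpha>(2) finB by (intro eventually_ball_finite) auto
  then have "\<forall>\<^sub>F x in nhds xbar. infdist x (feasible_set P) \<le> C * mpsc_residual P x"
    using eventually_branch_residual_eq[OF assms(1,2)]
  proof eventually_elim
    case (elim x)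
    then obtain b where b: "b \<in> ?B" "branch_residual P xbar (fst b) (snd b) x = mpsc_residual P x"
      by auto
    then have "infdist x (feasible_set P) \<le> \<alpha> b * mpsc_residual P x"
      using elim(1) by auto
    also have "\<dots> \<le> C * mpsc_residual P x"
      using \<alpha>_le[OF b(1)] residual_nonneg b(2) by (metis mult_right_mono)
    finally show ?case .
  qed
  then show ?thesis
    using \<open>C > 0\<close>
    by (auto simp: local_error_bound_def eventually_nhds_metric dist_norm mpsc_residual_def)
qed

end
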